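(* Let $d$ be a positive integer. The order induced on $\mathcal{G}_d$ by the total order on $\mathbb{N}$ through the map $g:\mathcal{G}_d\to\mathbb{N}$ is a refinement of the partial order $\prec$; that is, for $\mathsf{h}_1,\mathsf{h}_2\in\mathcal{G}_d$, $\mathsf{h}_1\prec\mathsf{h}_2$ implies $g(\mathsf{h}_1)<g(\mathsf{h}_2)$. In particular, for all integers $d\geq s\geq 2$, letting $\mathsf{h}^s(d):=(1,d-s+1,1^{s-2})$ and $\mathsf{g}^s(d):=g(\mathsf{h}^s(d))=\binom{s-1}{2}$, one has $\mathsf{h}^s(d)=\min(\mathcal{G}_d^s)$ with respect to $\prec$, and $\mathsf{g}^s(d)$ is the minimal genus corresponding to an O-sequence of length $s$ and multiplicity $d$ and it does not depend on $d$.
   Context: Binomial expansion: for positive integers $a,t$ write uniquely $a=\binom{k(t)}{t}+\binom{k(t-1)}{t-1}+\cdots+\binom{k(j)}{j}$ with $k(t)>k(t-1)>\cdots>k(j)\geq j\geq 1$, and set $a^{\langle t\rangle}:=\binom{k(t)+1}{t+1}+\binom{k(t-1)+1}{t}+\cdots+\binom{k(j)+1}{j+1}$; also $0^{\langle t\rangle}:=0$. Binomials satisfy $\binom{n}{m}=0$ for $n<m$. A function $\mathsf{h}:\mathbb{N}\to\mathbb{N}$ is an O-sequence (admissible) if $\mathsf{h}(0)=1$ and $\mathsf{h}(t+1)\leq \mathsf{h}(t)^{\langle t\rangle}$ for every $t\geq 1$. It is finite if $\mathsf{h}(t)=0$ for some $t$ (and then for all larger arguments); a finite O-sequence is written $(h_0,\ldots,h_{s-1})$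 with $h_{s-1}\neq 0$, $s$ is its length, and $e(\mathsf{h})=\sum_{i=0}^{s-1}h_i$ is its multiplicity. Finite sequences are extended by zeros when added or subtracted, and $\mathsf{e}_i$ denotes the sequence that is $1$ at index $i$ (indices starting from $0$) and $0$ elsewhere. The notation $1^{s-2}$ inside a sequence means $s-2$ consecutive entries equal to $1$. $\mathcal{G}_d$ is the set of finite O-sequences of multiplicity $d$ and $\mathcal{G}_d^s$ the subset of those of length $s$. The genus of a finite O-sequence $\mathsf{h}=(h_0,\ldots,h_{s-1})$ is $g(\mathsf{h}):=\sum_{j=2}^{s-1}(j-1)h_j$ (this is the arithmetic genus of any arithmetically Cohen-Macaulay curve with $h$-vector $\mathsf{h}$). Two elements $\mathsf{h}_1,\mathsf{h}_2\in\mathcal{G}_d$ are directly comparable if there is $\mathsf{h}_0\in\mathcal{G}_{d-1}$ with $\mathsf{h}_1=\mathsf{h}_0+\mathsf{e}_i$ and $\mathsf{h}_2=\mathsf{h}_0+\mathsf{e}_j$; in that case $\mathsf{h}_1\prec\mathsf{h}_2$ if and only if $i<j$. The partial order $\prec$ on $\mathcal{G}_d$ is the transitive closure of this relation. *)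

theory Defs
  imports Main
begin

text \<open>
  Sequences are functions \<open>nat \<Rightarrow> nat\<close>; a finite sequence \<open>(h 0, \<dots>, h (s - 1))\<close> is its extension
  by zeros.
\<close>

text \<open>
  The binomial expansion \<open>a = (k t choose t) + \<dots> + (k j choose j)\<close> with
  \<open>k t > \<dots> > k j \<ge> j \<ge> 1\<close>; the values of \<open>k\<close> outside \<open>{j..t}\<close> are irrelevant.
\<close>

definition binomial_expansion :: "nat \<Rightarrow> nat \<Rightarrow> nat \<Rightarrow> (nat \<Rightarrow> nat) \<Rightarrow> bool" where
  "binomial_expansion a t j k \<longleftrightarrow>
     1 \<le> j \<and> j \<le> t \<and> strict_mono_on {j..t} k \<and> j \<le> k j \<and>
     a = (\<Sum>i=j..t. k i choose i)"

text \<open>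
  \<open>macaulay_bound a t\<close> is usually written \<open>a\<close> with exponent \<open>\<langle>t\<rangle>\<close>. It is meaningful for \<open>t \<ge> 1\<close>;
  the description is proper there because the binomial expansion exists and is unique for \<open>a \<ge> 1\<close>.
\<close>

definition macaulay_bound :: "nat \<Rightarrow> nat \<Rightarrow> nat" where
  "macaulay_bound a t =
     (if a = 0 then 0
      else (THE b. \<exists>j k. binomial_expansion a t j k \<and>
                         b = (\<Sum>i=j..t. (k i + 1) choose (i + 1))))"

definition O_sequence :: "(nat \<Rightarrow> nat) \<Rightarrow> bool" where
  "O_sequence h \<longleftrightarrow> h 0 = 1 \<and> (\<forall>t\<ge>1. h (t + 1) \<le> macaulay_bound (h t) t)"

definition finite_O_sequence :: "(nat \<Rightarrow> nat) \<Rightarrow> bool" where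
  "finite_O_sequence h \<longleftrightarrow> O_sequence h \<and> (\<exists>t. h t = 0)"

text \<open>
  Once an O-sequence vanishes it stays zero, so the first zero of a finite O-sequence is the \<open>s\<close>
  with \<open>h = (h 0, \<dots>, h (s - 1))\<close> and \<open>h (s - 1) \<noteq> 0\<close>.
\<close>

definition seq_length :: "(nat \<Rightarrow> nat) \<Rightarrow> nat" where
  "seq_length h = (LEAST t. h t = 0)"

definition multiplicity :: "(nat \<Rightarrow> nat) \<Rightarrow> nat" where
  "multiplicity h = (\<Sum>i<seq_length h. h i)"

definition genus :: "(nat \<Rightarrow> nat) \<Rightarrow> nat" where
  "genus h = (\<Sum>j\<in>{2..<seq_length h}. (j - 1) * h j)"

definition OSeqs :: "nat \<Rightarrow> (nat \<Rightarrow> nat) set" where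
  "OSeqs d = {h. finite_O_sequence h \<and> multiplicity h = d}"

definition OSeqs_len :: "nat \<Rightarrow> nat \<Rightarrow> (nat \<Rightarrow> nat) set" where
  "OSeqs_len d s = {h \<in> OSeqs d. seq_length h = s}"

definition add_unit :: "(nat \<Rightarrow> nat) \<Rightarrow> nat \<Rightarrow> nat \<Rightarrow> nat" where
  "add_unit h i = (\<lambda>n. h n + (if n = i then 1 else 0))"

definition direct_prec :: "nat \<Rightarrow> (nat \<Rightarrow> nat) \<Rightarrow> (nat \<Rightarrow> nat) \<Rightarrow> bool" where
  "direct_prec d h1 h2 \<longleftrightarrow>
     h1 \<in> OSeqs d \<and> h2 \<in> OSeqs d \<and>
     (\<exists>h0 \<in> OSeqs (d - 1). \<exists>i j. i < j \<and> h1 = add_unit h0 i \<and> h2 = add_unit h0 j)"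

definition prec :: "nat \<Rightarrow> (nat \<Rightarrow> nat) \<Rightarrow> (nat \<Rightarrow> nat) \<Rightarrow> bool" where
  "prec d = (direct_prec d)\<^sup>+\<^sup>+"

definition seq_of_list :: "nat list \<Rightarrow> nat \<Rightarrow> nat" where
  "seq_of_list xs = (\<lambda>i. if i < length xs then xs ! i else 0)"

text \<open>The sequence \<open>(1, d - s + 1, 1, \<dots>, 1)\<close> with \<open>s - 2\<close> trailing ones, for \<open>d \<ge> s \<ge> 2\<close>.\<close>

definition h_min :: "nat \<Rightarrow> nat \<Rightarrow> nat \<Rightarrow> nat" where
  "h_min s d = seq_of_list ([1, d - s + 1] @ replicate (s - 2) 1)"

definition g_min :: "nat \<Rightarrow> nat \<Rightarrow> nat" where
  "g_min s d = genus (h_min s d)"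

end

(* The genus is the sum of (t - 1) * h t over the support. Moving a unit from position i to
   position j > i, with i >= 1, therefore raises it by j - i, so it increases along the order.
   For minimality: a sequence of length s other than the minimal one has a last position
   i >= 2 with value at least 2; moving a unit from i to position 1 gives a predecessor of the same
   length, as only the growth conditions at 1 and at i get harder, and they remain true because the
   Macaulay bound is monotone in degree 1 and positive on positive numbers. The genus decreases, so
   this terminates at the minimal sequence. *)

theory Submission
  imports Defs
begin

section \<open>Binomial expansions\<close>

text \<open>The inequality at the lowest index propagates upwards, because strict monotonicity
  raises \<open>k\<close> by at least one per index. Hence all binomials of an expansion are
  positive.\<close>

lemma binomial_expansion_ge_index:
  assumes "binomial_expansion a t j k" "i \<in> {j..t}"
  shows "i \<le> k i"
proof -
  have sm: "strict_mono_on {j..t} k" and jk: "j \<le> k j"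
    using assms(1) by (auto simp: binomial_expansion_def)
  have "j \<le> i" "i \<le> t" using assms(2) by auto
  then show ?thesis
  proof (induction i rule: dec_induct)
    case base
    show ?case by (rule jk)
  next
    case (step n)
    have "k n < k (Suc n)"
      using step by (intro strict_mono_onD[OF sm]) auto
    then show ?case using step by simp
  qed
qed

lemma binomial_expansion_pos:
  assumes "binomial_expansion a t j k"
  shows "a > 0"
proof -
  have "t \<le> k t" "j \<le> t" "a = (\<Sum>i=j..t. k i choose i)"
    using assms binomial_expansion_ge_index[OF assms, of t] by (auto simp: binomial_expansion_def)
  then show ?thesis by (auto intro!: sum_pos2[of _ t])
qed

lemma binomial_expansion_top:
  assumes "binomial_expansion a t t k"
  shows "a = k t choose t"
  using assms by (simp add: binomial_expansion_def)

lemma binomial_expansion_rest: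
  assumes "binomial_expansion a (Suc t) j k" "j \<le> t"
  obtains r where "binomial_expansion r t j k" "a = r + (k (Suc t) choose Suc t)"
proof
  show "binomial_expansion (\<Sum>i=j..t. k i choose i) t j k"
    using assms by (auto simp: binomial_expansion_def strict_mono_on_def)
  show "a = (\<Sum>i=j..t. k i choose i) + (k (Suc t) choose Suc t)"
    using assms by (auto simp: binomial_expansion_def)
qed

section \<open>Bracketing by the top entry and uniqueness of the expansion\<close>

lemma binomial_expansion_ge:
  assumes "binomial_expansion a t j k"
  shows "k t choose t \<le> a"
proof -
  have "j \<le> t" "a = (\<Sum>i=j..t. k i choose i)"
    using assms by (auto simp: binomial_expansion_def)
  then show ?thesis using member_le_sum[of t "{j..t}" "\<lambda>i. k i choose i"] by auto
qed

lemma choose_less_Suc_choose: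
  assumes "t \<ge> 1" "t \<le> n + 1"
  shows "n choose t < Suc n choose t"
  using assms by (cases t) (auto simp: zero_less_binomial_iff)

text \<open>By induction, the remainder below the top term is less than
  \<open>Suc (k t) choose t\<close>, hence less than \<open>k (Suc t) choose t\<close>; Pascal's
  rule then gives the bound. Together with \<open>binomial_expansion_ge\<close>, this determines the
  top entry from \<open>a\<close>.\<close>

lemma binomial_expansion_less:
  assumes "binomial_expansion a t j k"
  shows "a < Suc (k t) choose t"
  using assms
proof (induction t arbitrary: a)
  case 0
  then show ?case by (auto simp: binomial_expansion_def)
next
  case (Suc t)
  note ge = binomial_expansion_ge_index[OF Suc.prems, of "Suc t"]
  show ?case
  proof (cases "j = Suc t")
    case True
    then show ?thesis
      using Suc.prems ge binomial_expansion_top[of a "Suc t" k] choose_less_Suc_choose[of "Suc t" "k (Suc t)"]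
      by simp
  next
    case False
    then have jt: "j \<le> t" using Suc.prems by (simp add: binomial_expansion_def)
    obtain r where r: "binomial_expansion r t j k" "a = r + (k (Suc t) choose Suc t)"
      using binomial_expansion_rest[OF Suc.prems jt] .
    have "k t < k (Suc t)"
      using Suc.prems jt by (auto simp: binomial_expansion_def strict_mono_on_def)
    then have "Suc (k t) choose t \<le> k (Suc t) choose t"
      by (intro binomial_right_mono) simp
    then show ?thesis using Suc.IH[OF r(1)] r(2) by simp
  qed
qed

text \<open>The bracketing of \<open>a\<close> forces equal top entries, and the equal remainders
  are handled by induction. An expansion consisting of its top term alone has remainder 0, which no
  longer expansion can have.\<close>

lemma binomial_expansion_unique:
  assumes "binomial_expansion a t j k" "binomial_expansion a t j' k'"
  shows "j = j' \<and> (\<forall>i\<in>{j..t}. k i = k' i)"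
  using assms
proof (induction t arbitrary: a)
  case 0
  then show ?case by (simp add: binomial_expansion_def)
next
  case (Suc t)
  \<comment> \<open>Otherwise the upper bound for \<open>a\<close> from \<open>x\<close> would not
    exceed the lower bound from \<open>y\<close>.\<close>
  have no_less: "\<not> x (Suc t) < y (Suc t)"
    if "binomial_expansion a (Suc t) l x" "binomial_expansion a (Suc t) l' y" for l x l' y
  proof
    assume "x (Suc t) < y (Suc t)"
    then have "Suc (x (Suc t)) choose Suc t \<le> y (Suc t) choose Suc t"
      by (intro binomial_right_mono) simp
    then show False
      using binomial_expansion_less[OF that(1)] binomial_expansion_ge[OF that(2)] by linarith
  qed
  have top: "k (Suc t) = k' (Suc t)"
    using no_less[OF Suc.prems] no_less[OF Suc.prems(2,1)] by simp
  have le: "j \<le> Suc t" "j' \<le> Suc t"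
    using Suc.prems by (auto simp: binomial_expansion_def)
  have only_top: "l' = Suc t"
    if x: "binomial_expansion a (Suc t) (Suc t) x" and y: "binomial_expansion a (Suc t) l' y"
      and xy: "x (Suc t) = y (Suc t)" and l': "l' \<le> Suc t" for l' x y
  proof (rule ccontr)
    assume "l' \<noteq> Suc t"
    then have "l' \<le> t" using l' by simp
    then obtain r where "binomial_expansion r t l' y" "a = r + (y (Suc t) choose Suc t)"
      using binomial_expansion_rest[OF y] by blast
    then show False
      using binomial_expansion_pos[of r t l' y] binomial_expansion_top[OF x] xy by simp
  qed
  show ?case
  proof (cases "j = Suc t \<or> j' = Suc t")
    case True
    then have "j = Suc t \<and> j' = Suc t"
      using only_top[of k j' k'] only_top[of k' j k] Suc.prems top le by auto
    then show ?thesis using top by simp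
  next
    case False
    then have jt: "j \<le> t" "j' \<le> t" using le by auto
    obtain r where r: "binomial_expansion r t j k" "a = r + (k (Suc t) choose Suc t)"
      using binomial_expansion_rest[OF Suc.prems(1) jt(1)] .
    obtain r' where r': "binomial_expansion r' t j' k'" "a = r' + (k' (Suc t) choose Suc t)"
      using binomial_expansion_rest[OF Suc.prems(2) jt(2)] .
    have "r = r'" using r(2) r'(2) top by simp
    then have "j = j' \<and> (\<forall>i\<in>{j..t}. k i = k' i)" using Suc.IH[of r] r(1) r'(1) by simp
    then show ?thesis using top by (auto simp: le_Suc_eq)
  qed
qed

section \<open>Existence of the expansion by the greedy choice\<close>

lemma ex_greatest_choose_le:
  assumes "a \<ge> 1"
  shows "\<exists>n\<ge>Suc t. n choose Suc t \<le> a \<and> a < Suc n choose Suc t"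
proof -
  \<comment> \<open>These binomials are unbounded in \<open>n\<close>, so some value exceeds
    \<open>a\<close> and the \<open>LEAST\<close> below is proper; the entry sought is its
    predecessor.\<close>
  have ge: "n \<le> (n + t) choose Suc t" for n
  proof (induction n)
    case (Suc n)
    have "(n + t) choose t > 0" by (simp add: zero_less_binomial_iff)
    moreover have "(Suc n + t) choose Suc t = ((n + t) choose t) + ((n + t) choose Suc t)" by simp
    ultimately show ?case using Suc by linarith
  qed simp
  have bound: "a < (Suc a + t) choose Suc t"
    using ge[of "Suc a"] by linarith
  define N where "N = (LEAST n. a < n choose Suc t)"
  have N: "a < N choose Suc t" unfolding N_def using bound by (rule LeastI)
  then have "N \<noteq> 0" by (cases N) auto
  then obtain n where n: "N = Suc n" by (cases N) auto
  then have "\<not> a < n choose Suc t"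
    using not_less_Least[of n "\<lambda>n. a < n choose Suc t"] by (simp add: N_def)
  moreover have "Suc t \<le> n"
  proof (rule ccontr)
    assume "\<not> Suc t \<le> n"
    then have "N choose Suc t \<le> Suc t choose Suc t"
      using n by (intro binomial_right_mono) simp
    then show False using N assms by simp
  qed
  ultimately show ?thesis using n N by auto
qed

text \<open>Greedy algorithm: subtract the largest binomial of lower index \<open>Suc t\<close> that
  fits and expand the remainder in degree \<open>t\<close>.\<close>

lemma binomial_expansion_exists:
  assumes "t \<ge> 1" "a \<ge> 1"
  shows "\<exists>j k. binomial_expansion a t j k"
  using assms
proof (induction t arbitrary: a rule: dec_induct)
  case base
  then have "binomial_expansion a 1 1 (\<lambda>_. a)"
    by (simp add: binomial_expansion_def strict_mono_on_def)
  then show ?case by blast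
next
  case (step t)
  obtain n where n: "n \<ge> Suc t" "n choose Suc t \<le> a" "a < Suc n choose Suc t"
    using ex_greatest_choose_le[OF step.prems] by blast
  show ?case
  proof (cases "a = n choose Suc t")
    case True
    then have "binomial_expansion a (Suc t) (Suc t) (\<lambda>_. n)"
      using n by (simp add: binomial_expansion_def strict_mono_on_def)
    then show ?thesis by blast
  next
    case False
    define r where "r = a - (n choose Suc t)"
    \<comment> \<open>The upper bound on \<open>r\<close> is Pascal's rule applied to
      \<open>a < Suc n choose Suc t\<close>. It keeps the entries of the remainder's expansion below
      \<open>n\<close>, as strict monotonicity requires.\<close>
    have r: "r \<ge> 1" "r < n choose t" "a = r + (n choose Suc t)"
      using False n by (auto simp: r_def)
    obtain j k where jk: "binomial_expansion r t j k" using step.IH[OF r(1)] by blast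
    have "k t < n"
    proof (rule ccontr)
      assume "\<not> k t < n"
      then have "n choose t \<le> k t choose t" by (intro binomial_right_mono) simp
      then show False using binomial_expansion_ge[OF jk] r(2) by simp
    qed
    moreover have "k i \<le> k t" if "i \<in> {j..t}" for i
      using jk that by (cases "i = t") (auto simp: binomial_expansion_def strict_mono_on_def less_imp_le)
    ultimately have kn: "k i < n" if "i \<in> {j..t}" for i
      using that by fastforce
    have "binomial_expansion a (Suc t) j (k(Suc t := n))"
      using jk kn r(3) by (auto simp: binomial_expansion_def strict_mono_on_def le_Suc_eq)
    then show ?thesis by blast
  qed
qed

section \<open>Values and positivity of the Macaulay bound\<close>

lemma macaulay_bound_eq:
  assumes "binomial_expansion a t j k"
  shows "macaulay_bound a t = (\<Sum>i=j..t. (k i + 1) choose (i + 1))"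
proof -
  have "(THE b. \<exists>j k. binomial_expansion a t j k \<and> b = (\<Sum>i=j..t. (k i + 1) choose (i + 1)))
      = (\<Sum>i=j..t. (k i + 1) choose (i + 1))"
  proof (rule the_equality)
    fix b assume "\<exists>j k. binomial_expansion a t j k \<and> b = (\<Sum>i=j..t. (k i + 1) choose (i + 1))"
    then obtain j' k' where b: "binomial_expansion a t j' k'"
      "b = (\<Sum>i=j'..t. (k' i + 1) choose (i + 1))" by blast
    then show "b = (\<Sum>i=j..t. (k i + 1) choose (i + 1))"
      using binomial_expansion_unique[OF assms b(1)] by (auto intro!: sum.cong)
  qed (use assms in blast)
  then show ?thesis
    using binomial_expansion_pos[OF assms] by (simp add: macaulay_bound_def)
qed

lemma macaulay_bound_0 [simp]: "macaulay_bound 0 t = 0"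
  by (simp add: macaulay_bound_def)

text \<open>The top summand alone is positive, since \<open>t \<le> k t\<close>. Thus a positive
  entry may always be followed by an entry 1.\<close>

lemma macaulay_bound_pos:
  assumes "t \<ge> 1" "a \<ge> 1"
  shows "macaulay_bound a t \<ge> 1"
proof -
  obtain j k where jk: "binomial_expansion a t j k"
    using binomial_expansion_exists[OF assms] by blast
  have "t \<le> k t" "j \<le> t"
    using jk binomial_expansion_ge_index[OF jk, of t] by (auto simp: binomial_expansion_def)
  then have "(\<Sum>i=j..t. (k i + 1) choose (i + 1)) > 0"
    by (intro sum_pos2[of _ t]) (auto simp: zero_less_binomial_iff simp del: binomial_Suc_Suc)
  then show ?thesis using macaulay_bound_eq[OF jk] by simp
qed

text \<open>In degree 1 the expansion is the single term \<open>a choose 1\<close>. The closed form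
  makes monotonicity in \<open>a\<close> evident.\<close>

lemma macaulay_bound_1: "macaulay_bound a 1 = (a + 1) choose 2"
proof (cases "a = 0")
  case False
  then have "binomial_expansion a 1 1 (\<lambda>_. a)"
    by (simp add: binomial_expansion_def strict_mono_on_def)
  from macaulay_bound_eq[OF this] show ?thesis by (simp add: numeral_2_eq_2)
qed simp

section \<open>Finite O-sequences\<close>

lemma finite_O_sequence_nonzero_iff:
  assumes "finite_O_sequence h"
  shows "h t \<noteq> 0 \<longleftrightarrow> t < seq_length h"
proof -
  have O: "O_sequence h" and ex: "\<exists>t. h t = 0"
    using assms by (auto simp: finite_O_sequence_def)
  have z: "h (seq_length h) = 0" unfolding seq_length_def using ex by (rule LeastI_ex)
  have "h u = 0" if "seq_length h \<le> u" for u
    using that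
  proof (induction u rule: dec_induct)
    case (step n)
    \<comment> \<open>The growth condition starts in degree 1; index 0 is excluded because
      \<open>h 0 = 1\<close>.\<close>
    then have "n \<ge> 1" using O by (cases n) (auto simp: O_sequence_def)
    then have "h (Suc n) \<le> macaulay_bound (h n) n" using O by (auto simp: O_sequence_def)
    then show ?case using step by simp
  qed (rule z)
  moreover have "h u \<noteq> 0" if "u < seq_length h" for u
    using not_less_Least that unfolding seq_length_def by blast
  ultimately show ?thesis by (meson not_le)
qed

lemma seq_length_cong:
  assumes "\<And>t. h t = 0 \<longleftrightarrow> h' t = 0"
  shows "seq_length h = seq_length h'"
  using assms by (simp add: seq_length_def)

text \<open>The free bound \<open>N\<close> lets sequences of different lengths be summed over one
  range.\<close>

lemma multiplicity_eq:
  assumes "finite_O_sequence h" "seq_length h \<le> N"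
  shows "multiplicity h = (\<Sum>t<N. h t)"
proof -
  have "h t = 0" if "t \<ge> seq_length h" for t
    using finite_O_sequence_nonzero_iff[OF assms(1), of t] that by simp
  then show ?thesis
    unfolding multiplicity_def using assms(2) by (intro sum.mono_neutral_left) auto
qed

text \<open>For \<open>t < 2\<close> the truncated weight \<open>t - 1\<close> is zero, so the sum may start at \<open>0\<close>.\<close>

lemma genus_eq:
  assumes "finite_O_sequence h" "seq_length h \<le> N"
  shows "genus h = (\<Sum>t<N. (t - 1) * h t)"
proof -
  have "h t = 0" if "t \<ge> seq_length h" for t
    using finite_O_sequence_nonzero_iff[OF assms(1), of t] that by simp
  then show ?thesis
    unfolding genus_def using assms(2) by (intro sum.mono_neutral_left) (auto simp: not_less)
qed

text \<open>The weight \<open>w\<close> serves both invariants: constant 1 for the multiplicity,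
  \<open>t - 1\<close> for the genus.\<close>

lemma sum_add_unit:
  assumes "i < N"
  shows "(\<Sum>t<N. w t * add_unit h i t) = (\<Sum>t<N. w t * h t) + w i"
proof -
  have "(\<Sum>t<N. w t * add_unit h i t) = (\<Sum>t<N. w t * h t + (if t = i then w t else 0))"
    by (intro sum.cong) (auto simp: add_unit_def)
  then show ?thesis using assms by (simp add: sum.distrib)
qed

lemma
  assumes "finite_O_sequence h" "finite_O_sequence (add_unit h i)"
  shows multiplicity_add_unit: "multiplicity (add_unit h i) = multiplicity h + 1"
    and genus_add_unit: "genus (add_unit h i) = genus h + (i - 1)"
proof -
  \<comment> \<open>Adding a unit may lengthen the sequence, so \<open>N\<close> covers both
    lengths.\<close>
  define N where "N = max (seq_length h) (seq_length (add_unit h i))"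
  have "i < N"
    using finite_O_sequence_nonzero_iff[OF assms(2), of i] by (simp add: N_def add_unit_def)
  then show "multiplicity (add_unit h i) = multiplicity h + 1"
    using sum_add_unit[of i N "\<lambda>_. 1" h] multiplicity_eq[OF assms(1), of N]
      multiplicity_eq[OF assms(2), of N] by (simp add: N_def)
  show "genus (add_unit h i) = genus h + (i - 1)"
    using sum_add_unit[OF \<open>i < N\<close>, of "\<lambda>t. t - 1" h] genus_eq[OF assms(1), of N]
      genus_eq[OF assms(2), of N] by (simp add: N_def)
qed

section \<open>The genus and the order\<close>

lemma direct_prec_genus_less:
  assumes "direct_prec d h1 h2"
  shows "genus h1 < genus h2"
proof -
  obtain h0 i j where h0: "h0 \<in> OSeqs (d - 1)" "i < j" "h1 = add_unit h0 i" "h2 = add_unit h0 j"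
    and "h1 \<in> OSeqs d" "h2 \<in> OSeqs d"
    using assms by (auto simp: direct_prec_def)
  then have fin: "finite_O_sequence h0" "finite_O_sequence (add_unit h0 i)"
    "finite_O_sequence (add_unit h0 j)"
    by (auto simp: OSeqs_def)
  \<comment> \<open>A unit at position 0 would violate the value 1 there. This matters because the
    truncated weights of positions 0 and 1 are both 0.\<close>
  have "i \<noteq> 0"
    using fin(1,2) by (auto simp: finite_O_sequence_def O_sequence_def add_unit_def split: if_splits)
  then show ?thesis
    using genus_add_unit[OF fin(1,2)] genus_add_unit[OF fin(1,3)] h0(2-4) by simp
qed

lemma prec_genus_less:
  assumes "prec d h1 h2"
  shows "genus h1 < genus h2"
  using assms unfolding prec_def
  by (induction rule: tranclp_induct) (auto dest: direct_prec_genus_less)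

section \<open>The minimal sequence\<close>

lemma h_min_apply:
  assumes "2 \<le> s"
  shows "h_min s d t = (if t = 0 then 1 else if t = 1 then d - s + 1 else if t < s then 1 else 0)"
  using assms by (auto simp: h_min_def seq_of_list_def nth_Cons split: nat.split)

text \<open>Entries from position 2 on are at most 1, and a nonzero one follows a positive entry, so
  positivity of the bound suffices.\<close>

lemma finite_O_sequence_h_min:
  assumes "2 \<le> s"
  shows "finite_O_sequence (h_min s d)"
  unfolding finite_O_sequence_def O_sequence_def
proof (intro conjI allI impI)
  show "h_min s d 0 = 1" "\<exists>t. h_min s d t = 0"
    using assms by (auto simp: h_min_apply intro: exI[of _ s])
  fix t :: nat assume "t \<ge> 1"
  then show "h_min s d (t + 1) \<le> macaulay_bound (h_min s d t) t"
    using assms macaulay_bound_pos[of t "h_min s d t"] by (auto simp: h_min_apply)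
qed

lemma seq_length_h_min:
  assumes "2 \<le> s"
  shows "seq_length (h_min s d) = s"
  unfolding seq_length_def
  by (rule Least_equality) (use assms in \<open>auto simp: h_min_apply not_less split: if_splits\<close>)

lemma sum_lessThan_split:
  fixes h :: "nat \<Rightarrow> nat"
  assumes "2 \<le> s"
  shows "(\<Sum>t<s. h t) = h 0 + h 1 + (\<Sum>t=2..<s. h t)"
proof -
  have "(\<Sum>t<s. h t) = (\<Sum>t<2. h t) + (\<Sum>t=2..<s. h t)"
    using assms by (simp add: lessThan_atLeast0 sum.atLeastLessThan_concat)
  then show ?thesis by (simp add: numeral_2_eq_2)
qed

lemma h_min_mem:
  assumes "2 \<le> s" "s \<le> d"
  shows "h_min s d \<in> OSeqs_len d s"
proof -
  have "(\<Sum>t=2..<s. h_min s d t) = (\<Sum>t=2..<s. 1)"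
    using assms by (intro sum.cong) (auto simp: h_min_apply)
  then have "multiplicity (h_min s d) = d"
    using assms by (simp add: multiplicity_def seq_length_h_min sum_lessThan_split h_min_apply)
  then show ?thesis
    using assms by (simp add: OSeqs_len_def OSeqs_def finite_O_sequence_h_min seq_length_h_min)
qed

text \<open>Position 1, the only entry depending on \<open>d\<close>, has weight 0; the ones
  contribute the triangular number \<open>1 + ... + (s - 2)\<close>.\<close>

lemma g_min_eq:
  assumes "2 \<le> s"
  shows "g_min s d = (s - 1) choose 2"
proof -
  have "g_min s d = (\<Sum>j=2..<s. j - 1)"
    unfolding g_min_def genus_def seq_length_h_min[OF assms]
    using assms by (intro sum.cong) (auto simp: h_min_apply)
  also have "\<dots> = (s - 1) choose 2"
    using assms
  proof (induction s rule: dec_induct)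
    case (step n)
    then show ?case by (cases n) (simp_all add: numeral_2_eq_2)
  qed simp
  finally show ?thesis .
qed

text \<open>The support is exactly the positions below \<open>s\<close>, so the tail consists of
  ones, and the multiplicity then fixes \<open>h 1\<close>.\<close>

lemma eq_h_min:
  assumes "h \<in> OSeqs_len d s" "2 \<le> s" "\<And>t. 2 \<le> t \<Longrightarrow> h t \<le> 1"
  shows "h = h_min s d"
proof -
  have fin: "finite_O_sequence h" and len: "seq_length h = s" and mult: "(\<Sum>t<s. h t) = d"
    using assms(1) by (auto simp: OSeqs_len_def OSeqs_def multiplicity_def)
  have nz: "h t \<noteq> 0 \<longleftrightarrow> t < s" for t
    using finite_O_sequence_nonzero_iff[OF fin] len by simp
  have h0: "h 0 = 1" using fin by (simp add: finite_O_sequence_def O_sequence_def)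
  have tail: "h t = (if t < s then 1 else 0)" if "2 \<le> t" for t
    using assms(3)[OF that] nz[of t] by (cases "t < s") auto
  have "(\<Sum>t=2..<s. h t) = (\<Sum>t=2..<s. 1)" by (intro sum.cong) (auto simp: tail)
  then have "1 + h 1 + (s - 2) = d"
    using mult h0 sum_lessThan_split[OF assms(2), of h] by simp
  \<comment> \<open>Since \<open>h 1\<close> is positive, \<open>s \<le> d\<close>, so the
    subtraction is not truncated.\<close>
  then have h1: "h 1 = d - s + 1" using nz[of 1] assms(2) by simp
  show ?thesis
  proof
    fix t :: nat
    consider "t = 0" | "t = 1" | "2 \<le> t" by linarith
    then show "h t = h_min s d t"
      using h0 h1 tail assms(2) by cases (auto simp: h_min_apply)
  qed
qed

lemma ex_direct_predecessor:
  assumes h: "h \<in> OSeqs_len d s" and s: "2 \<le> s" and ne: "h \<noteq> h_min s d"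
  shows "\<exists>h' \<in> OSeqs_len d s. direct_prec d h' h"
proof -
  have fin: "finite_O_sequence h" and O: "O_sequence h" and len: "seq_length h = s"
    and mult: "multiplicity h = d"
    using h by (auto simp: OSeqs_len_def OSeqs_def finite_O_sequence_def)
  have nz: "h t \<noteq> 0 \<longleftrightarrow> t < s" for t
    using finite_O_sequence_nonzero_iff[OF fin] len by simp
  define A where "A = {t. 2 \<le> t \<and> 2 \<le> h t}"
  have "A \<subseteq> {..<s}" using nz by (force simp: A_def)
  then have finA: "finite A" by (rule finite_subset) simp
  have "A \<noteq> {}" using eq_h_min[OF h s] ne by (force simp: A_def)
  define i where "i = Max A"
  have i: "2 \<le> i" "2 \<le> h i"
    using Max_in[OF finA \<open>A \<noteq> {}\<close>] by (auto simp: i_def A_def)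
  \<comment> \<open>Maximality of \<open>i\<close> makes the next entry at most 1, so the lowered
    entry at \<open>i\<close> need only stay positive.\<close>
  have "Suc i \<notin> A" using Max_ge[OF finA, of "Suc i"] by (auto simp: i_def)
  then have next_le: "h (Suc i) \<le> 1" using i by (simp add: A_def)
  \<comment> \<open>\<open>h0\<close> is the common sequence of multiplicity \<open>d - 1\<close>: a
    unit at \<open>i\<close> restores \<open>h\<close>, a unit at 1 gives the predecessor.\<close>
  define h0 where "h0 = h(i := h i - 1)"
  define h' where "h' = add_unit h0 1"
  have O_step: "h (t + 1) \<le> macaulay_bound (h t) t" if "t \<ge> 1" for t
    using O that by (simp add: O_sequence_def)
  have at_i: "h (Suc i) \<le> macaulay_bound (h i - 1) i"
    using next_le macaulay_bound_pos[of i "h i - 1"] i by linarith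
  have step0: "h0 (t + 1) \<le> macaulay_bound (h0 t) t" if "t \<ge> 1" for t
    using O_step[OF that] at_i by (auto simp: h0_def)
  \<comment> \<open>The unit at position 1 changes only the bound in degree 1, and raises it
    weakly.\<close>
  have step': "h' (t + 1) \<le> macaulay_bound (h' t) t" if "t \<ge> 1" for t
  proof (cases "t = 1")
    case True
    have "(h0 1 + 1) choose 2 \<le> (h' 1 + 1) choose 2"
      by (intro binomial_right_mono) (simp add: h'_def add_unit_def)
    moreover have "h' (1 + 1) = h0 (1 + 1)" by (simp add: h'_def add_unit_def)
    ultimately have "h' (1 + 1) \<le> macaulay_bound (h' 1) 1"
      using step0[of 1] unfolding macaulay_bound_1 by simp
    then show ?thesis using True by simp
  qed (use step0[OF that] that in \<open>simp add: h'_def add_unit_def\<close>)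
  have "h 0 = 1" using O by (simp add: O_sequence_def)
  then have zero: "h0 0 = 1" "h' 0 = 1" using i by (auto simp: h0_def h'_def add_unit_def)
  \<comment> \<open>The entry at \<open>i\<close> was at least 2 and the entry at 1 was already
    nonzero, so the support, and with it the length, is preserved.\<close>
  have supp: "h0 t = 0 \<longleftrightarrow> h t = 0" "h' t = 0 \<longleftrightarrow> h t = 0" for t
    using i nz[of 1] s by (auto simp: h0_def h'_def add_unit_def)
  have fin0: "finite_O_sequence h0" and fin': "finite_O_sequence h'"
    using zero step0 step' supp fin by (auto simp: finite_O_sequence_def O_sequence_def)
  have h_eq: "h = add_unit h0 i" using i by (auto simp: h0_def add_unit_def)
  have mult0: "multiplicity h0 + 1 = d"
    using multiplicity_add_unit[OF fin0, of i] h_eq fin mult by simp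
  have mult': "multiplicity h' = d"
    using multiplicity_add_unit[OF fin0, of 1] fin' mult0 by (simp add: h'_def)
  have h'_mem: "h' \<in> OSeqs_len d s"
    using fin' mult' seq_length_cong[OF supp(2)] len by (simp add: OSeqs_len_def OSeqs_def)
  have "h0 \<in> OSeqs (d - 1)" using fin0 mult0 by (auto simp: OSeqs_def)
  then have "\<exists>h0 \<in> OSeqs (d - 1). \<exists>i j. i < j \<and> h' = add_unit h0 i \<and> h = add_unit h0 j"
    using h_eq h'_def i(1) by (intro bexI[of _ h0] exI[of _ 1] exI[of _ i]) auto
  then have "direct_prec d h' h"
    using h'_mem h by (simp add: direct_prec_def OSeqs_len_def)
  then show ?thesis using h'_mem by blast
qed

text \<open>Passing to direct predecessors of the same length strictly lowers the genus, so the
  descent stops, and it can stop only at \<open>h_min s d\<close>.\<close>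

lemma h_min_least:
  assumes "h \<in> OSeqs_len d s" "2 \<le> s"
  shows "h = h_min s d \<or> prec d (h_min s d) h"
  using assms(1)
proof (induction "genus h" arbitrary: h rule: less_induct)
  case less
  show ?case
  proof (cases "h = h_min s d")
    case False
    then obtain h' where h': "h' \<in> OSeqs_len d s" "direct_prec d h' h"
      using ex_direct_predecessor[OF less.prems assms(2)] by blast
    then have "h' = h_min s d \<or> prec d (h_min s d) h'"
      using less.hyps direct_prec_genus_less by blast
    then have "prec d (h_min s d) h"
      using h'(2) unfolding prec_def by (auto intro: tranclp.intros)
    then show ?thesis ..
  qed simp
qed

theorem corollary2p10:
  "(\<forall>d\<ge>1. \<forall>h1 \<in> OSeqs d. \<forall>h2 \<in> OSeqs d. prec d h1 h2 \<longrightarrow> genus h1 < genus h2) \<and>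
   (\<forall>d s. 2 \<le> s \<and> s \<le> d \<longrightarrow>
      g_min s d = (s - 1) choose 2 \<and>
      (h_min s d \<in> OSeqs_len d s \<and>
       (\<forall>h \<in> OSeqs_len d s. h = h_min s d \<or> prec d (h_min s d) h)) \<and>
      (g_min s d \<in> genus ` OSeqs_len d s \<and>
       (\<forall>h \<in> OSeqs_len d s. g_min s d \<le> genus h)) \<and>
      (\<forall>d'\<ge>s. g_min s d' = g_min s d))"
proof (intro conjI allI impI ballI)
  show "genus h1 < genus h2" if "prec d h1 h2" for d h1 h2
    using that by (rule prec_genus_less)
  fix d s :: nat
  assume ds: "2 \<le> s \<and> s \<le> d"
  then show "g_min s d = (s - 1) choose 2" by (simp add: g_min_eq)
  show mem: "h_min s d \<in> OSeqs_len d s" using ds by (simp add: h_min_mem)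
  then show "g_min s d \<in> genus ` OSeqs_len d s" by (simp add: g_min_def)
  show least: "h = h_min s d \<or> prec d (h_min s d) h" if "h \<in> OSeqs_len d s" for h
    using that ds by (simp add: h_min_least)
  \<comment> \<open>Being least in the order gives least genus, because the genus increases strictly
    along \<open>prec\<close>.\<close>
  show "g_min s d \<le> genus h" if "h \<in> OSeqs_len d s" for h
    using least[OF that] by (auto simp: g_min_def dest: prec_genus_less)
  show "g_min s d' = g_min s d" for d' using ds by (simp add: g_min_eq)
qed

end
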